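(* Let $\mathcal{M}$ be a (finite) semi-Eulerian simplicial complex of even dimension $d$. For each $n$ with $0\le n\le d$ let $f_n$ be the number of $n$-dimensional faces of $\mathcal{M}$. Then $$\chi(\mathcal{M})=\sum_{n=0}^{d}\beta_n f_n,$$ where $\beta_{n-2}=\dfrac{4(2^n-1)B_n}{n}$ for $n\ge 1$ and $B_n$ are the Bernoulli numbers.
   Context: For a finite simplicial complex $\mathcal{M}$, $f_n$ denotes the number of faces of dimension $n$ ($n\ge 0$), and the Euler characteristic is $\chi(\mathcal{M})=\sum_{n\ge 0}(-1)^n f_n$ (so the empty complex has Euler characteristic $0$). A semi-Eulerian complex of dimension $d$ is a pure finite simplicial complex of dimension $d$ (every maximal face has dimension $d$) such that for every (nonempty) face of dimension $n$, $0\le n\le d$, the link of this face has Euler characteristic $1-(-1)^{d+n}$, i.e. the same Euler characteristic as the sphere $\mathbb{S}^{d-n-1}$ (with $\mathbb{S}^{-1}=\emptyset$). The Bernoulli numbers $B_n$ are defined by $\frac{z}{e^z-1}=\sum_{n\ge 0}B_n\frac{z^n}{n!}$, so $B_1=-\tfrac12$. The sequence $\beta_n$ is indexed by $n\ge -1$; thus $\beta_{-1}=-2$, $\beta_0=1$, $\beta_2=-\tfrac12$, and $\beta_n=0$ for odd $n\ge 1$. *)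

theory Defs
  imports Complex_Main "HOL-Computational_Algebra.Formal_Power_Series"
begin

(* Complexes are abstract: a face is identified with its set of vertices, so it has dimension n
   iff it has n + 1 elements.  The empty face (of dimension -1) is not recorded; in particular
   the empty complex is {}. *)

definition abstract_simplicial_complex :: "'a set set \<Rightarrow> bool" where
  "abstract_simplicial_complex K \<longleftrightarrow>
     (\<forall>\<sigma>\<in>K. finite \<sigma> \<and> \<sigma> \<noteq> {}) \<and>
     (\<forall>\<sigma>\<in>K. \<forall>\<tau>. \<tau> \<subseteq> \<sigma> \<and> \<tau> \<noteq> {} \<longrightarrow> \<tau> \<in> K)"

definition faces_of_dim :: "'a set set \<Rightarrow> nat \<Rightarrow> 'a set set" where
  "faces_of_dim K n = {\<sigma> \<in> K. card \<sigma> = n + 1}"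

definition face_number :: "'a set set \<Rightarrow> nat \<Rightarrow> nat" where
  "face_number K n = card (faces_of_dim K n)"

(* For finite K the set of indices is finite, so this is the sum over all natural numbers n. *)
definition euler_char :: "'a set set \<Rightarrow> int" where
  "euler_char K = (\<Sum>n | face_number K n \<noteq> 0. (-1) ^ n * int (face_number K n))"

definition face_link :: "'a set set \<Rightarrow> 'a set \<Rightarrow> 'a set set" where
  "face_link K \<sigma> = {\<tau>. \<tau> \<noteq> {} \<and> \<tau> \<inter> \<sigma> = {} \<and> \<tau> \<union> \<sigma> \<in> K}"

definition maximal_face :: "'a set set \<Rightarrow> 'a set \<Rightarrow> bool" where
  "maximal_face K \<sigma> \<longleftrightarrow> \<sigma> \<in> K \<and> (\<forall>\<tau>\<in>K. \<sigma> \<subseteq> \<tau> \<longrightarrow> \<tau> = \<sigma>)"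

(* The empty complex has no maximal face; it is excluded since its dimension is -1. *)
definition pure_of_dim :: "'a set set \<Rightarrow> nat \<Rightarrow> bool" where
  "pure_of_dim K d \<longleftrightarrow> K \<noteq> {} \<and> (\<forall>\<sigma>. maximal_face K \<sigma> \<longrightarrow> \<sigma> \<in> faces_of_dim K d)"

definition semi_Eulerian :: "'a set set \<Rightarrow> nat \<Rightarrow> bool" where
  "semi_Eulerian K d \<longleftrightarrow>
     abstract_simplicial_complex K \<and> finite K \<and> pure_of_dim K d \<and>
     (\<forall>n\<le>d. \<forall>\<sigma>\<in>faces_of_dim K n. euler_char (face_link K \<sigma>) = 1 - (-1) ^ (d + n))"

definition bernoulli :: "nat \<Rightarrow> real" where
  "bernoulli n = fact n * fps_nth (fps_X / (fps_exp 1 - 1)) n"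

(* Only the values at m \<ge> -1 are meaningful. *)
definition beta_coeff :: "int \<Rightarrow> real" where
  "beta_coeff m = (let n = nat (m + 2) in 4 * (2 ^ n - 1) * bernoulli n / real n)"

lemma beta_coeff_shift:
  assumes "n \<ge> 1"
  shows "beta_coeff (int n - 2) = 4 * (2 ^ n - 1) * bernoulli n / real n"
  by (simp add: beta_coeff_def)

lemma bernoulli_gen_fun:
  "Abs_fps (\<lambda>n. bernoulli n / fact n) * (fps_exp 1 - 1) = fps_X"
proof -
  have nz: "fps_exp 1 - 1 \<noteq> (0 :: real fps)"
    by (auto simp: fps_eq_iff intro!: exI[of _ 1])
  have "subdegree (fps_exp 1 - 1 :: real fps) = 1"
    by (rule subdegreeI) auto
  then have "(fps_exp 1 - 1 :: real fps) dvd fps_X"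
    using nz by (simp add: fps_dvd_iff)
  moreover have "Abs_fps (\<lambda>n. bernoulli n / fact n) = fps_X / (fps_exp 1 - 1)"
    by (simp add: fps_eq_iff bernoulli_def)
  ultimately show ?thesis
    by simp
qed

end

(* Write b m for beta_coeff (m - 1).  The exponential generating function of b is
   -4 / (exp t + 1), so replacing t by -t multiplies it by exp t.  Comparing coefficients, the sum
   of b (card \<sigma>) over all subsets \<sigma> of an m-element set is (-1)^m * b m.  On the other hand, the
   link condition in even dimension says that for each face \<sigma> the sum of (-1)^(card \<tau> + 1) over
   the faces \<tau> containing \<sigma> is 1.  Insert this 1 into the sum of b (card \<sigma>) over all faces and
   exchange the two summations: since b 0 = -2, the sum S satisfies S = - S + 2 * \<chi>. *)
theory Submission
  imports Defs
begin

section \<open>The numbers \<open>\<beta>\<close>\<close>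

text \<open>With P(t) = t/(e^t - 1), the factor 2^n - 1 in \<open>beta_coeff\<close> makes t*Q(t) =
  4*(P(2t) - P(t)), where Q is the series on the left. Since e^(2t) - 1 = (e^t - 1)(e^t + 1), the
  difference collapses to -t/(e^t + 1).\<close>

lemma beta_coeff_gen_fun:
  "Abs_fps (\<lambda>m. beta_coeff (int m - 1) / fact m) * (fps_exp 1 + 1) = fps_const (-4)"
proof -
  define E :: "real fps" where "E = fps_exp 1"
  define P :: "real fps" where "P = Abs_fps (\<lambda>n. bernoulli n / fact n)"
  define Q :: "real fps" where "Q = Abs_fps (\<lambda>m. beta_coeff (int m - 1) / fact m)"
  define P2 where "P2 = fps_compose P (fps_const 2 * fps_X)"
  have P: "P * (E - 1) = fps_X"
    using bernoulli_gen_fun by (simp add: P_def E_def)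
  have E2: "fps_compose E (fps_const 2 * fps_X) = E * E"
    by (simp add: E_def fps_exp_compose_linear flip: fps_exp_add_mult)
  have "fps_compose (P * (E - 1)) (fps_const 2 * fps_X) = P2 * (E * E - 1)"
    by (subst fps_compose_mult_distrib)
      (simp_all add: P2_def fps_compose_sub_distrib E2)
  then have P2: "P2 * (E * E - 1) = fps_const 2 * fps_X"
    by (simp add: P)
  have P2_nth: "fps_nth P2 n = 2 ^ n * fps_nth P n" for n
    unfolding P2_def fps_compose_linear by simp
  have XQ: "fps_X * Q = fps_const 4 * (P2 - P)"
  proof (rule fps_ext)
    fix n
    show "fps_nth (fps_X * Q) n = fps_nth (fps_const 4 * (P2 - P)) n"
    proof (cases n)
      case 0
      then show ?thesis by (simp add: P2_nth)
    next
      case (Suc m)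
      \<comment> \<open>The factor \<open>fps_X\<close> shifts the index to \<open>Suc m\<close>,
        and the denominator \<open>Suc m\<close> of \<open>beta_coeff\<close> turns
        \<open>fact m\<close> into \<open>fact (Suc m)\<close>.\<close>
      have "beta_coeff (int m - 1) = 4 * (2 ^ Suc m - 1) * bernoulli (Suc m) / real (Suc m)"
        using beta_coeff_shift[of "Suc m"] by (simp add: algebra_simps)
      then have "beta_coeff (int m - 1) / fact m =
          4 * (2 ^ Suc m - 1) * (bernoulli (Suc m) / fact (Suc m))"
        by (simp only: fact_Suc divide_divide_eq_left times_divide_eq_right of_nat_mult)
      then show ?thesis
        by (simp only: Suc Q_def P2_nth P_def fps_X_mult_nth diff_Suc_1 nat.distinct if_False fps_mult_left_const_nth
            fps_sub_nth fps_nth_Abs_fps) (simp only: left_diff_distrib right_diff_distrib mult.assoc mult_1_left)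
    qed
  qed
  have nz: "E - 1 \<noteq> 0" "fps_X \<noteq> (0 :: real fps)"
    using P by auto
  \<comment> \<open>Clearing denominators avoids dividing series; the nonzero factor
    \<open>fps_X * (E - 1)\<close> is cancelled at the end. The bracket reduces by 2 - (E + 1) = -(E
    - 1).\<close>
  have "fps_X * (E - 1) * (Q * (E + 1)) = fps_const 4 * (P2 * (E * E - 1) - P * (E - 1) * (E + 1))"
    using XQ by algebra
  also have "\<dots> = fps_const 4 * (fps_const 2 * fps_X - fps_X * (E + 1))"
    by (simp add: P P2)
  also have "\<dots> = fps_X * (E - 1) * fps_const (-4)"
    unfolding fps_const_neg[symmetric] numeral_fps_const[symmetric] by algebra
  finally show ?thesis
    using nz by (simp add: Q_def E_def)
qed

text \<open>Q(t) = -4/(e^t + 1) satisfies Q(-t) = e^t * Q(t). Multiplication by e^t is the binomial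
  transform on exponential generating functions, and t -> -t inserts the sign.\<close>

lemma sum_binomial_beta_coeff:
  "(\<Sum>j\<le>m. real (m choose j) * beta_coeff (int j - 1)) = (-1) ^ m * beta_coeff (int m - 1)"
proof -
  define E :: "real fps" where "E = fps_exp 1"
  define Q :: "real fps" where "Q = Abs_fps (\<lambda>m. beta_coeff (int m - 1) / fact m)"
  define R where "R = fps_compose Q (fps_const (-1) * fps_X)"
  define F :: "real fps" where "F = fps_exp (-1)"
  have Q: "Q * (E + 1) = fps_const (-4)"
    using beta_coeff_gen_fun by (simp add: Q_def E_def)
  have "fps_compose (Q * (E + 1)) (fps_const (-1) * fps_X) = R * (F + 1)"
    by (subst fps_compose_mult_distrib)
      (simp_all add: R_def E_def F_def fps_compose_add_distrib fps_exp_compose_linear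
        del: fps_const_neg)
  then have R: "R * (F + 1) = fps_const (-4)"
    by (simp add: Q del: fps_const_neg)
  have EF: "E * F = 1"
    by (simp add: E_def F_def flip: fps_exp_add_mult)
  have nz: "E + 1 \<noteq> 0"
  proof
    assume "E + 1 = 0"
    then have "fps_const (-4 :: real) = 0"
      using Q by (metis mult_zero_right)
    then show False by simp
  qed
  \<comment> \<open>From \<open>E * F = 1\<close> follows E + 1 = E * (F + 1).\<close>
  have "R * (E + 1) = E * (R * (F + 1))"
    using EF by algebra
  also have "\<dots> = E * Q * (E + 1)"
    using R Q by (simp add: mult.assoc)
  finally have "R = E * Q"
    using nz by simp
  then have "fps_nth R m = fps_nth (Q * E) m"
    by (simp add: mult.commute)
  moreover have "fps_nth R m = (-1) ^ m * fps_nth Q m"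
    unfolding R_def fps_compose_linear by simp
  ultimately have coeff: "(-1) ^ m * (beta_coeff (int m - 1) / fact m) =
      (\<Sum>j\<le>m. beta_coeff (int j - 1) / fact j / fact (m - j))"
    by (simp add: Q_def E_def fps_mult_nth atLeast0AtMost)
  have "(-1) ^ m * beta_coeff (int m - 1) = fact m * ((-1) ^ m * (beta_coeff (int m - 1) / fact m))"
    by simp
  also have "\<dots> = (\<Sum>j\<le>m. fact m * (beta_coeff (int j - 1) / fact j / fact (m - j)))"
    unfolding coeff by (rule sum_distrib_left)
  also have "\<dots> = (\<Sum>j\<le>m. real (m choose j) * beta_coeff (int j - 1))"
    by (intro sum.cong) (auto simp: binomial_fact)
  finally show ?thesis by simp
qed

lemma sum_Pow_card:
  fixes h :: "nat \<Rightarrow> 'b::comm_semiring_1"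
  assumes "finite A"
  shows "(\<Sum>B\<in>Pow A. h (card B)) = (\<Sum>j\<le>card A. of_nat (card A choose j) * h j)"
proof -
  have "(\<Sum>B\<in>Pow A. h (card B)) = (\<Sum>j\<le>card A. \<Sum>B\<in>{B \<in> Pow A. card B = j}. h (card B))"
    using assms by (intro sum.group[symmetric]) (auto intro: card_mono)
  also have "\<dots> = (\<Sum>j\<le>card A. of_nat (card {B \<in> Pow A. card B = j}) * h j)"
    by (intro sum.cong) auto
  finally show ?thesis
    using n_subsets[OF assms] by simp
qed

lemma beta_coeff_minus_one: "beta_coeff (-1) = -2"
proof -
  \<comment> \<open>Reading off constant terms, where \<open>fps_exp 1 + 1\<close> contributes 2,
    avoids evaluating a Bernoulli number.\<close>
  have "fps_nth (Abs_fps (\<lambda>m. beta_coeff (int m - 1) / fact m) * (fps_exp 1 + 1)) 0 = - 4"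
    by (subst beta_coeff_gen_fun) simp
  then show ?thesis by simp
qed

text \<open>The empty set contributes \<open>beta_coeff (-1) = -2\<close> to the sum over
  \<open>Pow A\<close>; removing it gives the summand 2.\<close>

lemma sum_beta_coeff_nonempty_subsets:
  assumes "finite A"
  shows "(\<Sum>B\<in>Pow A - {{}}. beta_coeff (int (card B) - 1)) =
    (-1) ^ card A * beta_coeff (int (card A) - 1) + 2"
  using sum_Pow_card[OF assms, of "\<lambda>j. beta_coeff (int j - 1)"] assms
  by (simp add: sum_binomial_beta_coeff sum_diff1 beta_coeff_minus_one)

section \<open>Sums over faces\<close>

text \<open>Grouping faces by dimension. This serves both \<open>euler_char\<close>, with S the
  dimensions that occur, and the sum in the theorem, with S = {0..d}.\<close>

lemma sum_face_number:
  fixes h :: "nat \<Rightarrow> 'b::comm_semiring_1"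
  assumes "finite K" "{} \<notin> K" "\<forall>\<sigma>\<in>K. finite \<sigma>" "finite S" "\<forall>\<sigma>\<in>K. card \<sigma> - 1 \<in> S"
  shows "(\<Sum>n\<in>S. h n * of_nat (face_number K n)) = (\<Sum>\<sigma>\<in>K. h (card \<sigma> - 1))"
proof -
  have eq: "{\<sigma> \<in> K. card \<sigma> - 1 = n} = faces_of_dim K n" for n
  proof -
    have "card \<sigma> > 0" if "\<sigma> \<in> K" for \<sigma>
      using that assms(2,3) by (metis card_gt_0_iff)
    then show ?thesis
      unfolding faces_of_dim_def by force
  qed
  have "(\<Sum>\<sigma>\<in>K. h (card \<sigma> - 1)) = (\<Sum>n\<in>S. \<Sum>\<sigma>\<in>{\<sigma> \<in> K. card \<sigma> - 1 = n}. h (card \<sigma> - 1))"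
    using assms by (intro sum.group[symmetric]) auto
  also have "\<dots> = (\<Sum>n\<in>S. \<Sum>\<sigma>\<in>{\<sigma> \<in> K. card \<sigma> - 1 = n}. h n)"
    by (intro sum.cong) auto
  also have "\<dots> = (\<Sum>n\<in>S. h n * of_nat (face_number K n))"
    unfolding eq by (simp add: face_number_def mult.commute)
  finally show ?thesis by simp
qed

lemma euler_char_eq_sum_faces:
  assumes "finite K" "{} \<notin> K" "\<forall>\<sigma>\<in>K. finite \<sigma>"
  shows "euler_char K = (\<Sum>\<sigma>\<in>K. (-1) ^ (card \<sigma> + 1))"
proof -
  have pos: "card \<sigma> > 0" if "\<sigma> \<in> K" for \<sigma>
    using that assms(2,3) by (metis card_gt_0_iff)
  define S where "S = (\<lambda>\<sigma>. card \<sigma> - 1) ` K"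
  have "face_number K n \<noteq> 0 \<longleftrightarrow> n \<in> S" for n
    using assms(1) pos unfolding face_number_def faces_of_dim_def S_def
    by (force simp: card_eq_0_iff)
  then have "euler_char K = (\<Sum>n\<in>S. (-1) ^ n * int (face_number K n))"
    by (simp add: euler_char_def)
  also have "\<dots> = (\<Sum>\<sigma>\<in>K. (-1) ^ (card \<sigma> - 1))"
    using sum_face_number[OF assms, of S "\<lambda>n. (-1) ^ n"] assms(1) by (simp add: S_def)
  \<comment> \<open>The exponent \<open>card \<sigma> + 1\<close> has the same parity and is free of
    truncated subtraction.\<close>
  also have "\<dots> = (\<Sum>\<sigma>\<in>K. (-1) ^ (card \<sigma> + 1))"
  proof (intro sum.cong refl)
    fix \<sigma> assume "\<sigma> \<in> K"
    then obtain m where "card \<sigma> = Suc m"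
      using pos gr0_implies_Suc by blast
    then show "(-1) ^ (card \<sigma> - 1) = ((-1) ^ (card \<sigma> + 1) :: int)" by simp
  qed
  finally show ?thesis .
qed

text \<open>By finiteness every face lies in a maximal one, which has d + 1 vertices by
  purity.\<close>

lemma pure_of_dim_card_face_le:
  assumes "abstract_simplicial_complex K" "finite K" "pure_of_dim K d" "\<sigma> \<in> K"
  shows "card \<sigma> \<le> d + 1"
proof -
  obtain \<tau> where \<tau>: "\<tau> \<in> K" "\<sigma> \<subseteq> \<tau>" "\<forall>\<rho>\<in>K. \<tau> \<subseteq> \<rho> \<longrightarrow> \<tau> = \<rho>"
    using finite_has_maximal2[OF assms(2,4)] by blast
  then have "maximal_face K \<tau>"
    unfolding maximal_face_def by blast
  then have "card \<tau> = d + 1"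
    using assms(3) by (auto simp: pure_of_dim_def faces_of_dim_def)
  moreover have "finite \<tau>"
    using assms(1) \<tau>(1) by (auto simp: abstract_simplicial_complex_def)
  ultimately show ?thesis
    using \<tau>(2) by (metis card_mono)
qed

text \<open>Removing \<sigma> matches its proper cofaces with the faces of the link and lowers each
  cardinality by \<open>card \<sigma>\<close>, whence the sign in front.\<close>

lemma euler_char_face_link:
  assumes "abstract_simplicial_complex K" "finite K" "\<sigma> \<in> K"
  shows "euler_char (face_link K \<sigma>) =
    (-1) ^ card \<sigma> * (\<Sum>\<tau> | \<tau> \<in> K \<and> \<sigma> \<subset> \<tau>. (-1) ^ (card \<tau> + 1))"
proof -
  have fin: "finite \<tau>" if "\<tau> \<in> K" for \<tau>
    using assms(1) that by (auto simp: abstract_simplicial_complex_def)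
  have bij: "bij_betw (\<lambda>\<tau>. \<tau> - \<sigma>) {\<tau> \<in> K. \<sigma> \<subset> \<tau>} (face_link K \<sigma>)"
    by (rule bij_betwI[where g = "\<lambda>\<tau>. \<tau> \<union> \<sigma>"])
      (auto simp: face_link_def Un_absorb2 psubset_imp_subset)
  have "finite (face_link K \<sigma>)"
    using bij_betw_finite[OF bij] assms(2) by simp
  moreover have "\<forall>\<tau>\<in>face_link K \<sigma>. finite \<tau>"
    using fin unfolding face_link_def by blast
  moreover have "{} \<notin> face_link K \<sigma>"
    by (simp add: face_link_def)
  ultimately have "euler_char (face_link K \<sigma>) = (\<Sum>\<tau>\<in>face_link K \<sigma>. (-1) ^ (card \<tau> + 1))"
    by (intro euler_char_eq_sum_faces)
  also have "\<dots> = (\<Sum>\<tau> | \<tau> \<in> K \<and> \<sigma> \<subset> \<tau>. (-1) ^ (card (\<tau> - \<sigma>) + 1))"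
    by (rule sum.reindex_bij_betw[OF bij, symmetric])
  also have "\<dots> = (\<Sum>\<tau> | \<tau> \<in> K \<and> \<sigma> \<subset> \<tau>. (-1) ^ card \<sigma> * (-1) ^ (card \<tau> + 1))"
  proof (intro sum.cong refl)
    fix \<tau> assume "\<tau> \<in> {\<tau> \<in> K. \<sigma> \<subset> \<tau>}"
    then have "card \<tau> = card \<sigma> + card (\<tau> - \<sigma>)"
      using fin by (metis (mono_tags, lifting) card_Diff_subset card_mono le_add_diff_inverse
          finite_subset mem_Collect_eq psubset_imp_subset)
    then show "(-1) ^ (card (\<tau> - \<sigma>) + 1) = ((-1) ^ card \<sigma> * (-1) ^ (card \<tau> + 1) :: int)"
      by (simp add: power_add flip: power_mult_distrib)
  qed
  finally show ?thesis
    by (simp add: sum_distrib_left)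
qed

text \<open>With s = (-1)^(card \<sigma>), the link condition gives the proper cofaces the sum s*(1
  + s) = s + 1, and \<sigma> itself contributes -s.\<close>

lemma semi_Eulerian_even_sum_cofaces:
  assumes "semi_Eulerian K d" "even d" "\<sigma> \<in> K"
  shows "(\<Sum>\<tau> | \<tau> \<in> K \<and> \<sigma> \<subseteq> \<tau>. (-1) ^ (card \<tau> + 1)) = (1 :: int)"
proof -
  have K: "abstract_simplicial_complex K" "finite K" "pure_of_dim K d"
    using assms(1) by (auto simp: semi_Eulerian_def)
  define s :: int where "s = (-1) ^ card \<sigma>"
  have s: "s * s = 1"
    by (simp add: s_def flip: power_mult_distrib)
  have "finite \<sigma>" "\<sigma> \<noteq> {}"
    using K(1) assms(3) by (auto simp: abstract_simplicial_complex_def)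
  then obtain n where n: "card \<sigma> = n + 1"
    by (metis Suc_eq_plus1 card_eq_0_iff not0_implies_Suc)
  then have "n \<le> d" "\<sigma> \<in> faces_of_dim K n"
    using pure_of_dim_card_face_le[OF K assms(3)] assms(3) by (auto simp: faces_of_dim_def)
  then have "euler_char (face_link K \<sigma>) = 1 - (-1) ^ (d + n)"
    using assms(1) unfolding semi_Eulerian_def by blast
  \<comment> \<open>As d is even and \<open>card \<sigma> = n + 1\<close>, (-1)^(d + n) = (-1)^n =
    -s.\<close>
  also have "\<dots> = 1 + s"
    using assms(2) by (simp add: s_def n power_add)
  finally have "s * (\<Sum>\<tau> | \<tau> \<in> K \<and> \<sigma> \<subset> \<tau>. (-1) ^ (card \<tau> + 1)) = 1 + s"
    using euler_char_face_link[OF K(1,2) assms(3)] by (simp add: s_def)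
  then have "(\<Sum>\<tau> | \<tau> \<in> K \<and> \<sigma> \<subset> \<tau>. (-1) ^ (card \<tau> + 1)) = 1 + s"
    using s by algebra
  moreover have "{\<tau> \<in> K. \<sigma> \<subseteq> \<tau>} = insert \<sigma> {\<tau> \<in> K. \<sigma> \<subset> \<tau>}"
    using assms(3) by auto
  ultimately show ?thesis
    using K(2) by (simp add: s_def)
qed

theorem theorem1:
  fixes M :: "'a set set" and d :: nat
  assumes "semi_Eulerian M d"
    and "even d"
  shows "real_of_int (euler_char M) =
           (\<Sum>n = 0..d. beta_coeff (int n) * real (face_number M n))"
proof -
  define b where "b = (\<lambda>\<sigma> :: 'a set. beta_coeff (int (card \<sigma>) - 1))"
  define e :: "'a set \<Rightarrow> real" where "e = (\<lambda>\<sigma>. (-1) ^ (card \<sigma> + 1))"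
  have M: "abstract_simplicial_complex M" "finite M" "pure_of_dim M d"
    using assms(1) by (auto simp: semi_Eulerian_def)
  then have fin: "\<forall>\<sigma>\<in>M. finite \<sigma>" and ne: "{} \<notin> M"
    by (auto simp: abstract_simplicial_complex_def)
  have pos: "card \<sigma> \<ge> 1" if "\<sigma> \<in> M" for \<sigma>
    using that fin ne by (metis One_nat_def Suc_leI card_gt_0_iff)
  have cofaces: "(\<Sum>\<tau> | \<tau> \<in> M \<and> \<sigma> \<subseteq> \<tau>. e \<tau>) = 1" if "\<sigma> \<in> M" for \<sigma>
    using arg_cong[OF semi_Eulerian_even_sum_cofaces[OF assms that], of real_of_int]
    by (simp add: e_def)
  have chi: "real_of_int (euler_char M) = (\<Sum>\<sigma>\<in>M. e \<sigma>)"
    using euler_char_eq_sum_faces[OF M(2) ne fin] by (simp add: e_def)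
  have "(\<Sum>\<sigma>\<in>M. b \<sigma>) = (\<Sum>\<sigma>\<in>M. \<Sum>\<tau> | \<tau> \<in> M \<and> \<sigma> \<subseteq> \<tau>. b \<sigma> * e \<tau>)"
    by (intro sum.cong) (simp_all add: cofaces flip: sum_distrib_left)
  also have "\<dots> = (\<Sum>\<tau>\<in>M. \<Sum>\<sigma> | \<sigma> \<in> M \<and> \<sigma> \<subseteq> \<tau>. b \<sigma> * e \<tau>)"
    by (rule sum.swap_restrict[OF M(2) M(2)])
  also have "\<dots> = (\<Sum>\<tau>\<in>M. 2 * e \<tau> - b \<tau>)"
  proof (intro sum.cong refl)
    fix \<tau> assume \<tau>: "\<tau> \<in> M"
    \<comment> \<open>Closure under nonempty subsets makes the binomial identity applicable to the
      faces of \<tau>.\<close>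
    have "{\<sigma> \<in> M. \<sigma> \<subseteq> \<tau>} = Pow \<tau> - {{}}"
      using M(1) \<tau> unfolding abstract_simplicial_complex_def by blast
    then have "(\<Sum>\<sigma> | \<sigma> \<in> M \<and> \<sigma> \<subseteq> \<tau>. b \<sigma>) = (-1) ^ card \<tau> * b \<tau> + 2"
      using sum_beta_coeff_nonempty_subsets[of \<tau>] fin \<tau> by (simp add: b_def)
    then have "(\<Sum>\<sigma> | \<sigma> \<in> M \<and> \<sigma> \<subseteq> \<tau>. b \<sigma> * e \<tau>) = ((-1) ^ card \<tau> * b \<tau> + 2) * e \<tau>"
      by (simp flip: sum_distrib_right)
    \<comment> \<open>The signs (-1)^(card \<tau>) and \<open>e \<tau>\<close> are opposite, so
      their product is -1.\<close>
    also have "\<dots> = 2 * e \<tau> - b \<tau>"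
      by (cases "even (card \<tau>)") (simp_all add: e_def)
    finally show "(\<Sum>\<sigma> | \<sigma> \<in> M \<and> \<sigma> \<subseteq> \<tau>. b \<sigma> * e \<tau>) = 2 * e \<tau> - b \<tau>" .
  qed
  also have "\<dots> = 2 * (\<Sum>\<tau>\<in>M. e \<tau>) - (\<Sum>\<tau>\<in>M. b \<tau>)"
    by (simp add: sum_subtractf sum_distrib_left)
  finally have "(\<Sum>\<sigma>\<in>M. b \<sigma>) = real_of_int (euler_char M)"
    using chi by simp
  moreover have "(\<Sum>n = 0..d. beta_coeff (int n) * real (face_number M n)) =
      (\<Sum>\<sigma>\<in>M. beta_coeff (int (card \<sigma> - 1)))"
    using pure_of_dim_card_face_le[OF M]
    by (intro sum_face_number M fin ne) force+
  \<comment> \<open>Natural and integer subtraction of 1 agree here because faces are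
    nonempty.\<close>
  moreover have "\<dots> = (\<Sum>\<sigma>\<in>M. b \<sigma>)"
    using pos by (intro sum.cong) (simp_all add: b_def of_nat_diff)
  ultimately show ?thesis by simp
qed

end
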